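(* Let $r,s\in\mathbb{C}^*$ be roots of unity with $r^2\neq s^2$. Let $\epsilon=(\epsilon_1,\epsilon_2,\epsilon_3)$ and $\epsilon'=(\epsilon_1',\epsilon_2',\epsilon_3')$ be elements of $(\mathbb{C}^* )^3$, and let $\ell=\operatorname{lcm}(\operatorname{ord}(rs),\operatorname{ord}(rs^{-1}))$. Then $\mathcal{M}(\epsilon)$ is isomorphic to $\mathcal{M}(\epsilon')$ as a $U^+_{r,s}(B_2)$-module if and only if $$\epsilon_1^{\ell}=(\epsilon_1')^{\ell},\quad \epsilon_2=(rs)^u\epsilon_2',\quad \epsilon_3=(rs^{-1})^u\epsilon_3'$$ for some $u$ with $0\le u\le\ell-1$.
   Context: $U^+_{r,s}(B_2)$ is the unital associative $\mathbb{C}$-algebra generated by $e_1,e_2$ subject to $$e_1^2 e_2-(r^2+s^2)e_1e_2e_1+r^2s^2e_2e_1^2=0,$$ $$e_1e_2^3-(r^2+rs+s^2)e_2e_1e_2^2+rs(r^2+rs+s^2)e_2^2e_1e_2-r^3s^3e_2^3e_1=0.$$ Put $X_1=e_1$, $X_2=e_1e_2-r^2e_2e_1$, $X_3=e_2X_2-s^{-2}X_2e_2$, $X_4=e_2$. These satisfy $$X_1X_2=s^2X_2X_1,\quad X_1X_3=r^2s^2X_3X_1,\quad X_1X_4=r^2X_4X_1+X_2,$$ $$X_2X_3=rsX_3X_2,\quad X_2X_4=s^2X_4X_2-s^2X_3,\quad X_3X_4=rsX_4X_3,$$ and the monomials $X_1^aX_2^bX_3^cX_4^d$ form a basis. All modules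 are right modules; $\operatorname{ord}(z)$ is the multiplicative order of $z$. $\mathcal{M}(\epsilon)$ is the $U^+_{r,s}(B_2)$-module with basis $\{e(a):0\le a\le\ell-1\}$ and action ($\oplus$ is addition modulo $\ell$) $$e(a)X_1=\epsilon_1^2\epsilon_3\epsilon_2^{-1}\frac{1-rs^{-1}}{s^2(r^2-s^2)}s^{-2a}e(a\oplus2),\qquad e(a)X_2=\epsilon_1e(a\oplus1),$$ $$e(a)X_3=(rs)^a\epsilon_2e(a),\qquad e(a)X_4=\epsilon_1^{-1}\epsilon_2\epsilon_3^{-1}\frac{\left(\epsilon_3(rs^{-1})^a-1\right)s^{2a}}{1-rs^{-1}}e(a\oplus(-1)).$$ *)

theory Defs
  imports
    Complex_Main
    "HOL-Library.Poly_Mapping"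
    "HOL-Algebra.QuotRing"
    "HOL-Algebra.Multiplicative_Group"
    "HOL-Algebra.Algebraic_Closure_Type"
begin

section \<open>The algebra \<open>U\<^sup>+\<^sub>r\<^sub>,\<^sub>s(B\<^sub>2)\<close>\<close>

datatype gen = E1 | E2

text \<open>
  The free monoid on the two generators, written additively: the product on \<open>\<Rightarrow>\<^sub>0\<close> is
  convolution with respect to \<open>+\<close> on the exponents, so \<open>word \<Rightarrow>\<^sub>0 complex\<close> is the free
  unital associative algebra on \<open>E1\<close>, \<open>E2\<close>.
\<close>

datatype word = Word (letters: "gen list")

instantiation word :: monoid_add
begin
definition "0 = Word []"
definition "u + v = Word (letters u @ letters v)"
instance by standard (simp_all add: zero_word_def plus_word_def)
end

lemma letters_zero [simp]: "letters 0 = []"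
  by (simp add: zero_word_def)

lemma letters_plus [simp]: "letters (u + v) = letters u @ letters v"
  by (simp add: plus_word_def)

type_synonym free_alg = "word \<Rightarrow>\<^sub>0 complex"

definition gen :: "gen \<Rightarrow> free_alg"
  where "gen x = Poly_Mapping.single (Word [x]) 1"

definition scal :: "complex \<Rightarrow> free_alg"
  where "scal c = Poly_Mapping.single 0 c"

definition rel1 :: "complex \<Rightarrow> complex \<Rightarrow> free_alg"
  where "rel1 r s =
    gen E1 ^ 2 * gen E2 - scal (r^2 + s^2) * gen E1 * gen E2 * gen E1
      + scal (r^2 * s^2) * gen E2 * gen E1 ^ 2"

definition rel2 :: "complex \<Rightarrow> complex \<Rightarrow> free_alg"
  where "rel2 r s =
    gen E1 * gen E2 ^ 3 - scal (r^2 + r * s + s^2) * gen E2 * gen E1 * gen E2 ^ 2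
      + scal (r * s * (r^2 + r * s + s^2)) * gen E2 ^ 2 * gen E1 * gen E2
      - scal (r^3 * s^3) * gen E2 ^ 3 * gen E1"

abbreviation FA :: "free_alg ring"
  where "FA \<equiv> ring_of_type_algebra"

definition UB2_ideal :: "complex \<Rightarrow> complex \<Rightarrow> free_alg set"
  where "UB2_ideal r s = genideal FA {rel1 r s, rel2 r s}"

definition UB2 :: "complex \<Rightarrow> complex \<Rightarrow> free_alg set ring"
  where "UB2 r s = FA Quot UB2_ideal r s"

definition UB2_class :: "complex \<Rightarrow> complex \<Rightarrow> free_alg \<Rightarrow> free_alg set"
  where "UB2_class r s p = UB2_ideal r s +>\<^bsub>FA\<^esub> p"

text \<open>Representatives in the free algebra of the elements \<open>X\<^sub>1, \<dots>, X\<^sub>4\<close>.\<close>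

definition X1 :: free_alg where "X1 = gen E1"
definition X4 :: free_alg where "X4 = gen E2"
definition X2 :: "complex \<Rightarrow> free_alg"
  where "X2 r = gen E1 * gen E2 - scal (r^2) * gen E2 * gen E1"
definition X3 :: "complex \<Rightarrow> complex \<Rightarrow> free_alg"
  where "X3 r s = gen E2 * X2 r - scal (1 / s^2) * X2 r * gen E2"


section \<open>Right modules over a (not necessarily commutative) ring\<close>

text \<open>
  As for the library's \<^locale>\<open>module\<close>, the record extends \<open>ring\<close>, of which only the
  additive part is used.  For the quotient algebra above, the complex vector space structure of a
  right module is the action of the classes of the scalars \<open>scal c\<close>; so right modules
  over the ring are right modules over the algebra, and their homomorphisms are complex linear.
\<close>

record ('r, 'm) rmodule = "'m ring" +
  ract :: "'m \<Rightarrow> 'r \<Rightarrow> 'm" (infixl "\<lhd>\<index>" 70)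

locale right_module = R?: ring R + M?: abelian_group M
  for R :: "('r, 'x) ring_scheme" (structure) and M :: "('r, 'm, 'y) rmodule_scheme" (structure) +
  assumes ract_closed:
      "\<lbrakk>v \<in> carrier M; x \<in> carrier R\<rbrakk> \<Longrightarrow> v \<lhd>\<^bsub>M\<^esub> x \<in> carrier M"
    and ract_l_distr:
      "\<lbrakk>v \<in> carrier M; w \<in> carrier M; x \<in> carrier R\<rbrakk> \<Longrightarrow>
        (v \<oplus>\<^bsub>M\<^esub> w) \<lhd>\<^bsub>M\<^esub> x = (v \<lhd>\<^bsub>M\<^esub> x) \<oplus>\<^bsub>M\<^esub> (w \<lhd>\<^bsub>M\<^esub> x)"
    and ract_r_distr:
      "\<lbrakk>v \<in> carrier M; x \<in> carrier R; y \<in> carrier R\<rbrakk> \<Longrightarrow>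
        v \<lhd>\<^bsub>M\<^esub> (x \<oplus>\<^bsub>R\<^esub> y) = (v \<lhd>\<^bsub>M\<^esub> x) \<oplus>\<^bsub>M\<^esub> (v \<lhd>\<^bsub>M\<^esub> y)"
    and ract_mult:
      "\<lbrakk>v \<in> carrier M; x \<in> carrier R; y \<in> carrier R\<rbrakk> \<Longrightarrow>
        v \<lhd>\<^bsub>M\<^esub> (x \<otimes>\<^bsub>R\<^esub> y) = (v \<lhd>\<^bsub>M\<^esub> x) \<lhd>\<^bsub>M\<^esub> y"
    and ract_one:
      "v \<in> carrier M \<Longrightarrow> v \<lhd>\<^bsub>M\<^esub> \<one>\<^bsub>R\<^esub> = v"

definition rmodule_hom ::
    "('r, 'x) ring_scheme \<Rightarrow> ('r, 'm, 'y) rmodule_scheme \<Rightarrow> ('r, 'n, 'z) rmodule_scheme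
      \<Rightarrow> ('m \<Rightarrow> 'n) set"
  where "rmodule_hom R M N =
    {f. f \<in> carrier M \<rightarrow> carrier N \<and>
        (\<forall>v\<in>carrier M. \<forall>w\<in>carrier M. f (v \<oplus>\<^bsub>M\<^esub> w) = f v \<oplus>\<^bsub>N\<^esub> f w) \<and>
        (\<forall>v\<in>carrier M. \<forall>x\<in>carrier R. f (v \<lhd>\<^bsub>M\<^esub> x) = f v \<lhd>\<^bsub>N\<^esub> x)}"

definition rmodule_isomorphic ::
    "('r, 'x) ring_scheme \<Rightarrow> ('r, 'm, 'y) rmodule_scheme \<Rightarrow> ('r, 'n, 'z) rmodule_scheme \<Rightarrow> bool"
  where "rmodule_isomorphic R M N \<longleftrightarrow>
    (\<exists>f \<in> rmodule_hom R M N. bij_betw f (carrier M) (carrier N))"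


section \<open>The modules \<open>\<M>(\<epsilon>)\<close>\<close>

definition mord :: "complex \<Rightarrow> nat"
  where "mord z = group.ord (Multiplicative_Group.mult_of (ring_of_type_algebra :: complex ring)) z"

definition ell :: "complex \<Rightarrow> complex \<Rightarrow> nat"
  where "ell r s = lcm (mord (r * s)) (mord (r / s))"

text \<open>
  The underlying vector space of dimension \<open>n\<close> consists of the functions
  \<open>nat \<Rightarrow> complex\<close> vanishing outside \<open>{..<n}\<close>; \<open>bas a\<close> is the basis vector \<open>e(a)\<close>.
\<close>

definition vecs :: "nat \<Rightarrow> (nat \<Rightarrow> complex) set"
  where "vecs n = {v. \<forall>i\<ge>n. v i = 0}"

definition bas :: "nat \<Rightarrow> nat \<Rightarrow> complex"
  where "bas a = (\<lambda>i. if i = a then 1 else 0)"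

definition smul :: "complex \<Rightarrow> (nat \<Rightarrow> complex) \<Rightarrow> nat \<Rightarrow> complex"
  where "smul c v = (\<lambda>i. c * v i)"

definition lin_ext :: "nat \<Rightarrow> (nat \<Rightarrow> nat \<Rightarrow> complex) \<Rightarrow> (nat \<Rightarrow> complex) \<Rightarrow> nat \<Rightarrow> complex"
  where "lin_ext n g v = (\<lambda>i. \<Sum>a<n. v a * g a i)"

definition coef1 :: "complex \<Rightarrow> complex \<Rightarrow> complex \<Rightarrow> complex \<Rightarrow> complex \<Rightarrow> nat \<Rightarrow> complex"
  where "coef1 r s \<epsilon>1 \<epsilon>2 \<epsilon>3 a =
    \<epsilon>1^2 * \<epsilon>3 * inverse \<epsilon>2 * ((1 - r / s) / (s^2 * (r^2 - s^2))) * inverse (s ^ (2 * a))"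

definition coef4 :: "complex \<Rightarrow> complex \<Rightarrow> complex \<Rightarrow> complex \<Rightarrow> complex \<Rightarrow> nat \<Rightarrow> complex"
  where "coef4 r s \<epsilon>1 \<epsilon>2 \<epsilon>3 a =
    inverse \<epsilon>1 * \<epsilon>2 * inverse \<epsilon>3 * ((\<epsilon>3 * (r / s) ^ a - 1) * s ^ (2 * a) / (1 - r / s))"

text \<open>
  The generators \<open>e\<^sub>1 = X\<^sub>1\<close> and \<open>e\<^sub>2 = X\<^sub>4\<close> act by the prescribed formulas, extended
  linearly.  On \<open>{..<\<ell>}\<close> the index \<open>a \<oplus> (-1)\<close> is \<open>(a + \<ell> - 1) mod \<ell>\<close>.
\<close>

fun gen_act ::
    "complex \<Rightarrow> complex \<Rightarrow> complex \<Rightarrow> complex \<Rightarrow> complex \<Rightarrow> (nat \<Rightarrow> complex) \<Rightarrow> gen \<Rightarrow> nat \<Rightarrow> complex"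
  where
    "gen_act r s \<epsilon>1 \<epsilon>2 \<epsilon>3 v E1 =
      lin_ext (ell r s) (\<lambda>a. smul (coef1 r s \<epsilon>1 \<epsilon>2 \<epsilon>3 a) (bas ((a + 2) mod ell r s))) v"
  | "gen_act r s \<epsilon>1 \<epsilon>2 \<epsilon>3 v E2 =
      lin_ext (ell r s)
        (\<lambda>a. smul (coef4 r s \<epsilon>1 \<epsilon>2 \<epsilon>3 a) (bas ((a + ell r s - 1) mod ell r s))) v"

definition free_act ::
    "complex \<Rightarrow> complex \<Rightarrow> complex \<Rightarrow> complex \<Rightarrow> complex \<Rightarrow> (nat \<Rightarrow> complex) \<Rightarrow> free_alg \<Rightarrow> nat \<Rightarrow> complex"
  where "free_act r s \<epsilon>1 \<epsilon>2 \<epsilon>3 v p =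
    (\<lambda>i. \<Sum>w\<in>Poly_Mapping.keys p.
      Poly_Mapping.lookup p w * foldl (gen_act r s \<epsilon>1 \<epsilon>2 \<epsilon>3) v (letters w) i)"

text \<open>
  A class in the quotient acts as any of its representatives; independence of the representative
  is \<open>ract_Mmod\<close> below, \<open>right_module_Mmod\<close> shows that this is a right module, and
  \<open>Mmod_basis\<close> gives the action of all four \<open>X\<^sub>i\<close> on the basis.
\<close>

definition Mmod ::
    "complex \<Rightarrow> complex \<Rightarrow> complex \<Rightarrow> complex \<Rightarrow> complex \<Rightarrow> (free_alg set, nat \<Rightarrow> complex) rmodule"
  where "Mmod r s \<epsilon>1 \<epsilon>2 \<epsilon>3 =
    \<lparr>carrier = vecs (ell r s), monoid.mult = (\<lambda>_ _. undefined), monoid.one = undefined,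
     ring.zero = (\<lambda>_. 0), add = (\<lambda>v w i. v i + w i),
     ract = (\<lambda>v C. THE w. \<forall>p\<in>C. w = free_act r s \<epsilon>1 \<epsilon>2 \<epsilon>3 v p)\<rparr>"


section \<open>Well-definedness\<close>

lemma pow_eq_1_iff_mord:
  assumes "z \<noteq> 0"
  shows "z ^ n = 1 \<longleftrightarrow> mord z dvd n"
proof -
  interpret F: field "ring_of_type_algebra :: complex ring" by (rule field_from_type_algebra)
  interpret G: group "Multiplicative_Group.mult_of (ring_of_type_algebra :: complex ring)" by (rule F.field_mult_group)
  have "z [^]\<^bsub>Multiplicative_Group.mult_of ring_of_type_algebra\<^esub> n = z ^ n" for n :: nat
    by (induction n) (simp_all add: nat_pow_def Multiplicative_Group.mult_of_def ring_of_type_algebra_def mult.commute)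
  moreover have "z \<in> carrier (Multiplicative_Group.mult_of ring_of_type_algebra)"
    using assms by (simp add: ring_of_type_algebra_def)
  ultimately show ?thesis
    using G.pow_eq_id[of z n] by (simp add: mord_def) (simp add: ring_of_type_algebra_def)
qed

lemma ring_FA: "ring FA"
proof -
  have "\<exists>y. x + y = 0" for x :: free_alg
    using add.right_inverse by blast
  thus ?thesis
    unfolding ring_of_type_algebra_def using add.right_inverse
    by unfold_locales (auto simp: algebra_simps Units_def)
qed

lemma FA_simps [simp]:
  "carrier FA = UNIV" "monoid.mult FA = (*)" "monoid.one FA = 1" "ring.zero FA = 0" "ring.add FA = (+)"
  by (simp_all add: ring_of_type_algebra_def fun_eq_iff)

lemma ideal_UB2: "ideal (UB2_ideal r s) FA"
  unfolding UB2_ideal_def by (intro ring.genideal_ideal[OF ring_FA]) simp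

lemma ring_UB2: "ring (UB2 r s)"
  unfolding UB2_def by (rule ideal.quotient_is_ring[OF ideal_UB2])

lemma carrier_UB2: "carrier (UB2 r s) = range (UB2_class r s)"
  by (auto simp: UB2_def UB2_class_def FactRing_def A_RCOSETS_defs a_r_coset_def r_coset_def
      ring_of_type_algebra_def)

lemma UB2_class_hom: "UB2_class r s \<in> ring_hom FA (UB2 r s)"
  using ideal.rcos_ring_hom[OF ideal_UB2] by (simp add: UB2_def UB2_class_def [abs_def])

lemma UB2_class_mult: "UB2_class r s p \<otimes>\<^bsub>UB2 r s\<^esub> UB2_class r s q = UB2_class r s (p * q)"
  using ring_hom_mult[OF UB2_class_hom, of p q] by simp

lemma UB2_class_add: "UB2_class r s p \<oplus>\<^bsub>UB2 r s\<^esub> UB2_class r s q = UB2_class r s (p + q)"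
  using ring_hom_add[OF UB2_class_hom, of p q] by simp

lemma UB2_class_one: "\<one>\<^bsub>UB2 r s\<^esub> = UB2_class r s 1"
  using ring_hom_one[OF UB2_class_hom] by simp

lemma in_UB2_class: "q \<in> UB2_class r s p \<longleftrightarrow> (\<exists>h\<in>UB2_ideal r s. q = h + p)"
  by (auto simp: UB2_class_def a_r_coset_def r_coset_def ring_of_type_algebra_def)

lemma self_in_UB2_class: "p \<in> UB2_class r s p"
proof -
  interpret ideal "UB2_ideal r s" FA by (rule ideal_UB2)
  have "0 \<in> UB2_ideal r s" using additive_subgroup.zero_closed[OF is_additive_subgroup] by simp
  thus ?thesis by (force simp: in_UB2_class)
qed

lemma poly_mapping_sum_single:
  "p = (\<Sum>w\<in>Poly_Mapping.keys p. Poly_Mapping.single w (Poly_Mapping.lookup p w))"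
proof (rule poly_mapping_eqI)
  fix k
  have "Poly_Mapping.lookup (\<Sum>w\<in>Poly_Mapping.keys p. Poly_Mapping.single w (Poly_Mapping.lookup p w)) k
      = (\<Sum>w\<in>Poly_Mapping.keys p. if w = k then Poly_Mapping.lookup p k else 0)"
    by (auto simp: lookup_sum lookup_single when_def intro!: sum.cong)
  also have "\<dots> = Poly_Mapping.lookup p k"
    by (simp add: in_keys_iff)
  finally show "Poly_Mapping.lookup p k =
    Poly_Mapping.lookup (\<Sum>w\<in>Poly_Mapping.keys p. Poly_Mapping.single w (Poly_Mapping.lookup p w)) k" ..
qed

context
  fixes r s \<epsilon>1 \<epsilon>2 \<epsilon>3 :: complex
  assumes r: "\<exists>n>0. r ^ n = 1" and s: "\<exists>n>0. s ^ n = 1" and rs: "r\<^sup>2 \<noteq> s\<^sup>2"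
    and eps: "\<epsilon>1 \<noteq> 0" "\<epsilon>2 \<noteq> 0" "\<epsilon>3 \<noteq> 0"
begin

private abbreviation (input) "L \<equiv> ell r s"
private abbreviation (input) "ga \<equiv> gen_act r s \<epsilon>1 \<epsilon>2 \<epsilon>3"
private abbreviation (input) "wa \<equiv> foldl (gen_act r s \<epsilon>1 \<epsilon>2 \<epsilon>3)"
private abbreviation (input) "fa \<equiv> free_act r s \<epsilon>1 \<epsilon>2 \<epsilon>3"
private abbreviation (input) "c1 \<equiv> coef1 r s \<epsilon>1 \<epsilon>2 \<epsilon>3"
private abbreviation (input) "c4 \<equiv> coef4 r s \<epsilon>1 \<epsilon>2 \<epsilon>3"

lemma r0: "r \<noteq> 0" and s0: "s \<noteq> 0"
  using r s by (auto simp: power_0_left)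

lemma L_pos: "L > 0"
proof -
  obtain m n where mn: "m > 0" "n > 0" "r ^ m = 1" "s ^ n = 1" using r s by auto
  have a: "r ^ (m * n) = 1" using mn by (simp add: power_mult)
  have b: "s ^ (m * n) = 1" using mn power_mult[of s n m] by (simp add: mult.commute)
  have "(r * s) ^ (m * n) = 1" "(r / s) ^ (m * n) = 1"
    using a b by (simp_all add: power_mult_distrib power_divide)
  hence "mord (r * s) dvd m * n" "mord (r / s) dvd m * n"
    using pow_eq_1_iff_mord[of "r * s"] pow_eq_1_iff_mord[of "r / s"] r0 s0 by auto
  moreover have "m * n > 0" using mn by simp
  ultimately have "mord (r * s) > 0" "mord (r / s) > 0"
    by (metis dvd_0_left_iff gr0I less_not_refl)+
  thus ?thesis by (simp add: ell_def lcm_pos_nat)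
qed

lemma pow_L: "(r * s) ^ L = 1" "(r / s) ^ L = 1" "s ^ (2 * L) = 1"
proof -
  show a: "(r * s) ^ L = 1"
    using pow_eq_1_iff_mord[of "r * s"] r0 s0 by (simp add: ell_def)
  show b: "(r / s) ^ L = 1"
    using pow_eq_1_iff_mord[of "r / s"] r0 s0 by (simp add: ell_def)
  have "s ^ (2 * L) = (r * s) ^ L / (r / s) ^ L"
    using r0 s0 by (simp add: power_mult_distrib power_divide field_simps power_mult power2_eq_square)
  thus "s ^ (2 * L) = 1" using a b by simp
qed

lemma pow_mod: "z ^ L = (1::complex) \<Longrightarrow> z ^ (n mod L) = z ^ n"
  by (metis div_mult_mod_eq mult.commute mult_1 power_add power_mult power_one)

lemma s2_mod: "s ^ (2 * (n mod L)) = s ^ (2 * n)"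
  using pow_mod[of "s ^ 2" n] pow_L(3) by (simp add: power_mult)

lemma c1_mod: "c1 (n mod L) = c1 n"
  by (simp add: coef1_def s2_mod)

lemma c4_mod: "c4 (n mod L) = c4 n"
  by (simp add: coef4_def s2_mod pow_mod[OF pow_L(2)])

private definition bm :: "nat \<Rightarrow> nat \<Rightarrow> complex" where "bm n = bas (n mod L)"

lemma lin_ext_bm: "lin_ext L g (bm n) = g (n mod L)"
proof
  fix i
  have "(\<Sum>a<L. bas (n mod L) a * g a i) = (\<Sum>a<L. if a = n mod L then g a i else 0)"
    by (intro sum.cong) (auto simp: bas_def)
  also have "\<dots> = g (n mod L) i" using L_pos by simp
  finally show "lin_ext L g (bm n) i = g (n mod L) i" by (simp add: lin_ext_def bm_def)
qed

lemma ga_bm: "ga (bm n) E1 = smul (c1 n) (bm (n + 2))" "ga (bm (Suc n)) E2 = smul (c4 (Suc n)) (bm n)"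
proof -
  show "ga (bm n) E1 = smul (c1 n) (bm (n + 2))"
    by (simp add: lin_ext_bm c1_mod) (simp add: bm_def mod_simps)
  have "(Suc n mod L + L - 1) mod L = (Suc n mod L + (L - 1)) mod L" using L_pos by simp
  also have "\<dots> = (Suc n + (L - 1)) mod L" by (simp add: mod_simps)
  also have "Suc n + (L - 1) = n + L" using L_pos by simp
  finally have "(Suc n mod L + L - 1) mod L = n mod L" by simp
  thus "ga (bm (Suc n)) E2 = smul (c4 (Suc n)) (bm n)"
    by (simp add: lin_ext_bm c4_mod) (simp add: bm_def)
qed

lemma bm_add: "bm (n + k * L) = bm n" by (simp add: bm_def)

lemma ga_add: "ga (\<lambda>i. v i + w i) x = (\<lambda>i. ga v x i + ga w x i)"
  by (cases x) (simp_all add: lin_ext_def sum.distrib algebra_simps)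

lemma ga_smul: "ga (smul c v) x = smul c (ga v x)"
  by (cases x) (simp_all add: lin_ext_def smul_def sum_distrib_left algebra_simps)

lemma ga_closed: "ga v x \<in> vecs L"
proof -
  have "bas (k mod L) i = 0" if "i \<ge> L" for k i
  proof -
    have "k mod L < L" using L_pos by simp
    thus ?thesis using that by (simp add: bas_def)
  qed
  thus ?thesis by (cases x) (simp_all add: vecs_def lin_ext_def smul_def)
qed

lemma wa_add: "wa (\<lambda>i. v i + w i) xs = (\<lambda>i. wa v xs i + wa w xs i)"
  by (induction xs arbitrary: v w) (simp_all add: ga_add del: gen_act.simps)

lemma wa_smul: "wa (smul c v) xs = smul c (wa v xs)"
  by (induction xs arbitrary: v) (simp_all add: ga_smul del: gen_act.simps)

lemma wa_closed: "v \<in> vecs L \<Longrightarrow> wa v xs \<in> vecs L"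
  by (induction xs arbitrary: v) (simp_all add: ga_closed del: gen_act.simps)

lemma fa_superset:
  assumes "finite A" "Poly_Mapping.keys p \<subseteq> A"
  shows "fa v p i = (\<Sum>w\<in>A. Poly_Mapping.lookup p w * wa v (letters w) i)"
  unfolding free_act_def using assms by (intro sum.mono_neutral_left) (auto simp: in_keys_iff)

lemma fa_plus: "fa v (p + q) = (\<lambda>i. fa v p i + fa v q i)"
proof
  fix i
  let ?A = "Poly_Mapping.keys p \<union> Poly_Mapping.keys q"
  have "Poly_Mapping.keys (p + q) \<subseteq> ?A" by (rule Poly_Mapping.keys_add)
  thus "fa v (p + q) i = fa v p i + fa v q i"
    using fa_superset[of ?A "p + q" v i] fa_superset[of ?A p v i] fa_superset[of ?A q v i]
    by (simp add: lookup_add algebra_simps sum.distrib)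
qed

lemma fa_single: "fa v (Poly_Mapping.single w c) = smul c (wa v (letters w))"
  by (auto simp: fun_eq_iff free_act_def smul_def)

lemma fa_zero: "fa v 0 = (\<lambda>_. 0)"
  by (simp add: free_act_def)

lemma fa_sum: "fa v (sum f A) = (\<lambda>i. \<Sum>x\<in>A. fa v (f x) i)"
  by (induction A rule: infinite_finite_induct) (simp_all add: fa_zero fa_plus)

lemma fa_uminus: "fa v (- p) = (\<lambda>i. - fa v p i)"
proof
  fix i have "fa v (p + - p) i = 0" by (simp add: fa_zero)
  thus "fa v (- p) i = - fa v p i" unfolding fa_plus by (simp add: add_eq_0_iff)
qed

lemma fa_minus: "fa v (p - q) = (\<lambda>i. fa v p i - fa v q i)"
  using fa_plus[of v p "- q"] by (simp add: fa_uminus)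

lemma fa_vadd: "fa (\<lambda>i. v i + w i) p = (\<lambda>i. fa v p i + fa w p i)"
  by (simp add: free_act_def wa_add algebra_simps sum.distrib)

lemma fa_vsmul: "fa (smul c v) p = smul c (fa v p)"
  by (simp add: free_act_def wa_smul) (simp add: smul_def sum_distrib_left algebra_simps)

lemma fa_vzero: "fa (\<lambda>_. 0) p = (\<lambda>_. 0)"
  using fa_vsmul[of 0 "\<lambda>_. 0" p] by (simp add: smul_def)

lemma fa_vsum: "fa (\<lambda>i. \<Sum>x\<in>A. g x i) p = (\<lambda>i. \<Sum>x\<in>A. fa (g x) p i)"
  by (induction A rule: infinite_finite_induct) (simp_all add: fa_vzero fa_vadd)

lemma fa_closed: "v \<in> vecs L \<Longrightarrow> fa v p \<in> vecs L"
  using wa_closed[of v] by (auto simp: vecs_def free_act_def intro!: sum.neutral)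

lemma vecs_add: "v \<in> vecs L \<Longrightarrow> w \<in> vecs L \<Longrightarrow> (\<lambda>i. v i + w i) \<in> vecs L"
  by (simp add: vecs_def)

lemma fa_one: "fa v 1 = v"
  using fa_single[of v 0 1] by (simp add: smul_def)

lemma fa_single_mult:
  "fa v (Poly_Mapping.single k a * Poly_Mapping.single l b) =
    fa (fa v (Poly_Mapping.single k a)) (Poly_Mapping.single l b)"
  by (simp add: mult_single fa_single wa_smul) (simp add: smul_def mult_ac)

lemma fa_mult: "fa v (p * q) = fa (fa v p) q"
proof -
  let ?S = "\<lambda>p w. Poly_Mapping.single w (Poly_Mapping.lookup p w)"
  have "fa v (p * q) = fa v ((\<Sum>k\<in>Poly_Mapping.keys p. ?S p k) * (\<Sum>l\<in>Poly_Mapping.keys q. ?S q l))"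
    by (simp flip: poly_mapping_sum_single)
  also have "\<dots> = (\<lambda>i. \<Sum>k\<in>Poly_Mapping.keys p. \<Sum>l\<in>Poly_Mapping.keys q. fa (fa v (?S p k)) (?S q l) i)"
    by (simp add: sum_product fa_sum fa_single_mult)
  also have "\<dots> = fa (fa v (\<Sum>k\<in>Poly_Mapping.keys p. ?S p k)) (\<Sum>l\<in>Poly_Mapping.keys q. ?S q l)"
    by (simp add: fa_sum fa_vsum sum.swap[of _ "Poly_Mapping.keys p"])
  also have "\<dots> = fa (fa v p) q"
    by (simp flip: poly_mapping_sum_single)
  finally show ?thesis .
qed

lemma fa_gen: "fa v (gen x) = ga v x"
  by (simp add: gen_def fa_single smul_def del: gen_act.simps)

lemma fa_scal: "fa v (scal c) = smul c v"
  by (simp add: scal_def fa_single)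

lemmas fa_rules = fa_plus fa_minus fa_mult fa_gen fa_scal power2_eq_square power3_eq_cube

private definition "KK = \<epsilon>1^2 * \<epsilon>3 * inverse \<epsilon>2 * ((1 - r / s) / (s^2 * (r^2 - s^2)))"
private definition "DD = inverse \<epsilon>1 * \<epsilon>2 * inverse \<epsilon>3 / (1 - r / s)"

lemma nz: "1 - r / s \<noteq> 0" "r^2 - s^2 \<noteq> 0"
  using rs s0 by (auto simp: field_simps)

lemma KD: "KK * DD = \<epsilon>1 / (s^2 * (r^2 - s^2))"
  using eps nz s0 by (simp add: KK_def DD_def divide_simps power2_eq_square)

private definition "AA n = DD * \<epsilon>3 * (r / s) ^ n * s ^ (2 * n)"
private definition "BB n = DD * s ^ (2 * n)"

lemma AA_Suc: "AA (Suc n) = AA n * (r * s)"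
  using s0 by (simp add: AA_def)

lemma BB_Suc: "BB (Suc n) = BB n * (s * s)"
  by (simp add: BB_def)

lemma c4_eq: "c4 n = AA n - BB n"
  by (simp add: coef4_def DD_def AA_def BB_def divide_inverse algebra_simps)

lemma c1_eq: "c1 n = KK / s ^ (2 * n)"
  by (simp add: coef1_def KK_def divide_inverse)

lemma c1_Suc: "c1 n = c1 (Suc n) * (s * s)"
  using s0 by (simp add: c1_eq)

lemma gas:
  "ga (smul c (bm n)) E1 = smul (c * c1 n) (bm (Suc (Suc n)))"
  "ga (smul c (bm (Suc n))) E2 = smul (c * c4 (Suc n)) (bm n)"
  by (simp_all only: ga_smul ga_bm) (simp_all add: smul_def mult.assoc)

lemma smul_smul: "smul c (smul d v) = smul (c * d) v"
  by (simp add: smul_def mult.assoc)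

lemma smul_1: "smul 1 v = v"
  by (simp add: smul_def)

lemma basis_rel1: "fa (bm (Suc n)) (rel1 r s) = (\<lambda>_. 0)"
proof -
  define C where "C = c1 (Suc (Suc (Suc n)))"
  have c: "c1 (Suc (Suc n)) = C * (s * s)" "c1 (Suc n) = C * (s * s) * (s * s)"
      "c1 n = C * (s * s) * (s * s) * (s * s)"
    using c1_Suc[of n] c1_Suc[of "Suc n"] c1_Suc[of "Suc (Suc n)"] by (simp_all add: C_def)
  have "fa (smul 1 (bm (Suc n))) (rel1 r s) = (\<lambda>_. 0)"
    unfolding rel1_def fa_rules gas smul_smul c C_def[symmetric] c4_eq AA_Suc BB_Suc
    by (simp add: smul_def fun_eq_iff algebra_simps)
  thus ?thesis by (simp add: smul_1)
qed

lemma basis_rel2: "fa (bm (Suc (Suc (Suc n)))) (rel2 r s) = (\<lambda>_. 0)"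
proof -
  define C where "C = c1 (Suc (Suc (Suc n)))"
  have c: "c1 (Suc (Suc n)) = C * (s * s)" "c1 (Suc n) = C * (s * s) * (s * s)"
      "c1 n = C * (s * s) * (s * s) * (s * s)"
    using c1_Suc[of n] c1_Suc[of "Suc n"] c1_Suc[of "Suc (Suc n)"] by (simp_all add: C_def)
  have "fa (smul 1 (bm (Suc (Suc (Suc n))))) (rel2 r s) = (\<lambda>_. 0)"
    unfolding rel2_def fa_rules gas smul_smul c C_def[symmetric] c4_eq AA_Suc BB_Suc
    by (simp add: smul_def fun_eq_iff algebra_simps)
  thus ?thesis by (simp add: smul_1)
qed

lemma vec_basis: "v \<in> vecs L \<Longrightarrow> v = (\<lambda>i. \<Sum>a<L. smul (v a) (bm a) i)"
proof
  fix i assume v: "v \<in> vecs L"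
  have "(\<Sum>a<L. smul (v a) (bm a) i) = (\<Sum>a<L. if a = i then v a else 0)"
    by (intro sum.cong) (auto simp: smul_def bm_def bas_def)
  also have "\<dots> = v i" using v by (auto simp: vecs_def)
  finally show "v i = (\<Sum>a<L. smul (v a) (bm a) i)" ..
qed

lemma fa_basis:
  assumes "v \<in> vecs L"
  shows "fa v p = (\<lambda>i. \<Sum>a<L. smul (v a) (fa (bm a) p) i)"
  by (subst vec_basis[OF assms]) (simp add: fa_vsum fa_vsmul)

lemma bm_shift: obtains m where "bm a = bm (Suc (Suc (Suc m)))"
proof -
  have "a + 3 * L = Suc (Suc (Suc (a + 3 * L - 3)))" using L_pos by simp
  thus ?thesis using that[of "a + 3 * L - 3"] bm_add[of a 3] by simp
qed

lemma act_rel: "v \<in> vecs L \<Longrightarrow> fa v (rel1 r s) = (\<lambda>_. 0)" "v \<in> vecs L \<Longrightarrow> fa v (rel2 r s) = (\<lambda>_. 0)"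
proof -
  have "fa (bm a) (rel1 r s) = (\<lambda>_. 0)" "fa (bm a) (rel2 r s) = (\<lambda>_. 0)" for a
    using bm_shift[of a] basis_rel1 basis_rel2 by metis+
  thus "v \<in> vecs L \<Longrightarrow> fa v (rel1 r s) = (\<lambda>_. 0)" "v \<in> vecs L \<Longrightarrow> fa v (rel2 r s) = (\<lambda>_. 0)"
    by (simp_all add: fa_basis smul_def)
qed

lemma act_ideal:
  assumes "h \<in> UB2_ideal r s" "v \<in> vecs L"
  shows "fa v h = (\<lambda>_. 0)"
proof -
  define J where "J = {p. \<forall>v\<in>vecs L. fa v p = (\<lambda>_. 0)}"
  interpret FA: ring FA by (rule ring_FA)
  have uminus: "\<ominus>\<^bsub>FA\<^esub> p = - p" for p :: free_alg
    by (rule FA.minus_equality) simp_all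
  have "ideal J FA"
  proof (rule idealI[OF ring_FA])
    show "subgroup J (add_monoid FA)"
    proof (rule FA.add.subgroupI)
      show "\<ominus>\<^bsub>FA\<^esub> p \<in> J" if "p \<in> J" for p
        using that by (auto simp: J_def uminus fa_uminus)
    qed (auto simp: J_def fa_plus fa_zero intro!: exI[of _ 0])
  qed (auto simp: J_def fa_mult fa_vzero fa_closed)
  moreover have "{rel1 r s, rel2 r s} \<subseteq> J" by (auto simp: J_def act_rel)
  ultimately have "UB2_ideal r s \<subseteq> J" unfolding UB2_ideal_def by (rule FA.genideal_minimal)
  thus ?thesis using assms by (auto simp: J_def)
qed

private abbreviation (input) "MM \<equiv> Mmod r s \<epsilon>1 \<epsilon>2 \<epsilon>3"

lemma ract_Mmod:
  assumes "v \<in> carrier MM"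
  shows "v \<lhd>\<^bsub>MM\<^esub> UB2_class r s p = fa v p"
proof -
  have v: "v \<in> vecs L" using assms by (simp add: Mmod_def)
  have eq: "fa v q = fa v p" if "q \<in> UB2_class r s p" for q
    using that act_ideal[OF _ v] by (auto simp: in_UB2_class fa_plus)
  have "(THE w. \<forall>q\<in>UB2_class r s p. w = fa v q) = fa v p"
  proof (rule the_equality)
    show "w = fa v p" if "\<forall>q\<in>UB2_class r s p. w = fa v q" for w
      using that self_in_UB2_class[of p r s] by (rule bspec)
  qed (simp add: eq)
  thus ?thesis by (simp add: Mmod_def)
qed

lemma Mmod_simps: "carrier MM = vecs L" "\<zero>\<^bsub>MM\<^esub> = (\<lambda>_. 0)" "v \<oplus>\<^bsub>MM\<^esub> w = (\<lambda>i. v i + w i)"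
  by (simp_all add: Mmod_def)

lemma right_module_Mmod: "right_module (UB2 r s) MM"
proof -
  have "abelian_group MM"
  proof (rule abelian_groupI)
    fix v assume "v \<in> carrier MM"
    thus "\<exists>w\<in>carrier MM. w \<oplus>\<^bsub>MM\<^esub> v = \<zero>\<^bsub>MM\<^esub>"
      by (intro bexI[of _ "\<lambda>i. - v i"]) (auto simp: Mmod_simps vecs_def)
  qed (auto simp: Mmod_simps vecs_def algebra_simps)
  moreover have "right_module_axioms (UB2 r s) MM"
    by (rule right_module_axioms.intro)
       (auto simp: carrier_UB2 UB2_class_mult UB2_class_add UB2_class_one ract_Mmod
          Mmod_simps fa_closed vecs_add fa_vadd fa_plus fa_mult fa_one)
  ultimately show ?thesis using ring_UB2 by (intro right_module.intro)
qed

lemma basis_X2: "fa (bm n) (X2 r) = smul \<epsilon>1 (bm (Suc n))"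
proof -
  obtain m where "n + L = Suc m" using L_pos by (metis Suc_pred add_gr_0)
  hence m: "bm n = bm (Suc m)" "bm (Suc n) = bm (Suc (Suc m))"
    using bm_add[of n 1] bm_add[of "Suc n" 1] by simp_all
  have "c1 m * BB m = KK * DD"
    using s0 by (simp add: c1_eq BB_def)
  moreover have "c1 (Suc m) * c4 (Suc (Suc (Suc m))) - r^2 * (c4 (Suc m) * c1 m)
      = c1 (Suc m) * (s * s) * (s * s) * BB m * (r^2 - s^2)"
    unfolding c1_Suc[of m] c4_eq AA_Suc BB_Suc by (simp add: algebra_simps power2_eq_square)
  ultimately have "c1 (Suc m) * c4 (Suc (Suc (Suc m))) - r^2 * (c4 (Suc m) * c1 m)
      = KK * DD * (s^2 * (r^2 - s^2))"
    unfolding c1_Suc[of m, symmetric] by (simp add: power2_eq_square mult_ac)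
  also have "\<dots> = \<epsilon>1" using KD nz s0 by simp
  finally have "fa (smul 1 (bm (Suc m))) (X2 r) = smul \<epsilon>1 (bm (Suc (Suc m)))"
    unfolding X2_def fa_minus fa_mult fa_gen fa_scal gas smul_smul
    by (simp add: smul_def fun_eq_iff mult.assoc) (metis left_diff_distrib mult.assoc)
  thus ?thesis by (simp add: smul_1 m)
qed

lemma basis_X3: "fa (bm n) (X3 r s) = smul ((r * s) ^ n * \<epsilon>2) (bm n)"
proof -
  have gen: "fa (bm (Suc m)) (X3 r s) = smul ((r * s) ^ (Suc m) * \<epsilon>2) (bm (Suc m))" for m
  proof -
    have DD1: "DD * \<epsilon>1 * \<epsilon>3 * (1 - r / s) = \<epsilon>2"
      using eps nz(1) by (simp add: DD_def) (simp add: field_simps)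
    have "AA (Suc m) = DD * \<epsilon>3 * (r * s) ^ Suc m"
    proof -
      have "(r / s) ^ Suc m * s ^ (2 * Suc m) = (r / s * s^2) ^ Suc m"
        by (simp only: power_mult power_mult_distrib)
      also have "r / s * s^2 = r * s" using s0 by (simp add: power2_eq_square)
      finally show ?thesis by (simp only: AA_def mult.assoc)
    qed
    hence "AA (Suc m) * \<epsilon>1 * (1 - r / s) = (r * s) ^ Suc m * (DD * \<epsilon>1 * \<epsilon>3 * (1 - r / s))"
      by (simp only: mult_ac)
    hence 1: "AA (Suc m) * \<epsilon>1 * (1 - r / s) = (r * s) ^ Suc m * \<epsilon>2"
      by (simp only: DD1)
    have "c4 (Suc m) * \<epsilon>1 - 1 / s^2 * \<epsilon>1 * c4 (Suc (Suc m)) = AA (Suc m) * \<epsilon>1 * (1 - r / s)"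
      unfolding c4_eq AA_Suc[of "Suc m"] BB_Suc[of "Suc m"]
      using s0 by (simp add: field_simps power2_eq_square)
    hence 2: "c4 (Suc m) * \<epsilon>1 - 1 / s^2 * \<epsilon>1 * c4 (Suc (Suc m)) = (r * s) ^ Suc m * \<epsilon>2"
      by (simp only: 1)
    have X2s: "fa (smul c (bm k)) (X2 r) = smul (c * \<epsilon>1) (bm (Suc k))" for c k
      by (simp add: fa_vsmul basis_X2 smul_smul)
    have "fa (smul 1 (bm (Suc m))) (X3 r s) =
        (\<lambda>i. smul (1 * c4 (Suc m) * \<epsilon>1) (bm (Suc m)) i
           - smul (1 / s^2 * 1 * \<epsilon>1 * c4 (Suc (Suc m))) (bm (Suc m)) i)"
      unfolding X3_def fa_minus fa_mult fa_gen fa_scal smul_smul gas X2s ..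
    also have "\<dots> = smul (c4 (Suc m) * \<epsilon>1 - 1 / s^2 * \<epsilon>1 * c4 (Suc (Suc m))) (bm (Suc m))"
      by (simp add: smul_def left_diff_distrib)
    finally show ?thesis by (simp only: 2 smul_1)
  qed
  obtain m where m: "n + L = Suc m" using L_pos by (metis Suc_pred add_gr_0)
  have "bm n = bm (Suc m)" using bm_add[of n 1] by (simp add: m)
  moreover have "(r * s) ^ (Suc m) = (r * s) ^ n"
    unfolding m[symmetric] by (simp add: power_add pow_L(1))
  ultimately show ?thesis using gen[of m] by (simp only:)
qed

lemma Mmod_basis:
  assumes "a < L"
  shows
    "bas a \<lhd>\<^bsub>MM\<^esub> UB2_class r s X1 =
      smul (\<epsilon>1^2 * \<epsilon>3 * inverse \<epsilon>2 * ((1 - r / s) / (s^2 * (r^2 - s^2))) * inverse (s ^ (2 * a)))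
        (bas ((a + 2) mod L))"
    "bas a \<lhd>\<^bsub>MM\<^esub> UB2_class r s (X2 r) = smul \<epsilon>1 (bas ((a + 1) mod L))"
    "bas a \<lhd>\<^bsub>MM\<^esub> UB2_class r s (X3 r s) = smul ((r * s) ^ a * \<epsilon>2) (bas a)"
    "bas a \<lhd>\<^bsub>MM\<^esub> UB2_class r s X4 =
      smul (inverse \<epsilon>1 * \<epsilon>2 * inverse \<epsilon>3 * ((\<epsilon>3 * (r / s) ^ a - 1) * s ^ (2 * a) / (1 - r / s)))
        (bas ((a + L - 1) mod L))"
    "bas a \<lhd>\<^bsub>MM\<^esub> UB2_class r s (scal c) = smul c (bas a)"
proof -
  have b: "bas a = bm a" and m: "a mod L = a" using assms by (simp_all add: bm_def)
  have c: "bm a \<in> carrier MM" using assms b by (auto simp: Mmod_simps vecs_def bas_def bm_def)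
  show "bas a \<lhd>\<^bsub>MM\<^esub> UB2_class r s X1 =
      smul (\<epsilon>1^2 * \<epsilon>3 * inverse \<epsilon>2 * ((1 - r / s) / (s^2 * (r^2 - s^2))) * inverse (s ^ (2 * a)))
        (bas ((a + 2) mod L))"
    unfolding b ract_Mmod[OF c] X1_def fa_gen gen_act.simps lin_ext_bm m coef1_def ..
  show "bas a \<lhd>\<^bsub>MM\<^esub> UB2_class r s X4 =
      smul (inverse \<epsilon>1 * \<epsilon>2 * inverse \<epsilon>3 * ((\<epsilon>3 * (r / s) ^ a - 1) * s ^ (2 * a) / (1 - r / s)))
        (bas ((a + L - 1) mod L))"
    unfolding b ract_Mmod[OF c] X4_def fa_gen gen_act.simps lin_ext_bm m coef4_def ..
  show "bas a \<lhd>\<^bsub>MM\<^esub> UB2_class r s (X2 r) = smul \<epsilon>1 (bas ((a + 1) mod L))"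
    unfolding b ract_Mmod[OF c] basis_X2 by (simp add: bm_def)
  show "bas a \<lhd>\<^bsub>MM\<^esub> UB2_class r s (X3 r s) = smul ((r * s) ^ a * \<epsilon>2) (bas a)"
    unfolding b ract_Mmod[OF c] basis_X3 ..
  show "bas a \<lhd>\<^bsub>MM\<^esub> UB2_class r s (scal c) = smul c (bas a)"
    unfolding b ract_Mmod[OF c] fa_scal ..
qed

end
end

theory Submission
  imports Defs
begin

text \<open>
  All \<open>X\<^sub>i\<close> act as weighted cyclic shifts of the basis.  The elements \<open>X\<^sub>3\<close>, \<open>X\<^sub>4 X\<^sub>2\<close> and \<open>X\<^sub>2\<^sup>\<ell>\<close> act diagonally; comparing
  eigenvalues at a nonzero coordinate \<open>u\<close> of the image of \<open>e(0)\<close> under an isomorphism yields the three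
  conditions.  Conversely, \<open>e(a) \<mapsto> (\<epsilon>\<^sub>1' / \<epsilon>\<^sub>1)\<^sup>a e'(a \<oplus> u)\<close> is an isomorphism; it is well behaved
  on the cyclic index because \<open>(\<epsilon>\<^sub>1' / \<epsilon>\<^sub>1)\<^sup>\<ell> = 1\<close>.
\<close>

section \<open>Weighted cyclic shifts\<close>

text \<open>With indices read modulo \<open>n\<close>, a weight vector and a shift amount record the
  operator; composition then reduces to arithmetic on weights and shifts.\<close>

definition wshift :: "nat \<Rightarrow> (nat \<Rightarrow> complex) \<Rightarrow> nat \<Rightarrow> (nat \<Rightarrow> complex) \<Rightarrow> nat \<Rightarrow> complex"
  where "wshift n c k = lin_ext n (\<lambda>a. smul (c a) (bas ((a + k) mod n)))"

lemma lin_ext_add: "lin_ext n g (\<lambda>i. v i + w i) = (\<lambda>i. lin_ext n g v i + lin_ext n g w i)"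
  by (simp add: lin_ext_def algebra_simps sum.distrib)

lemma lin_ext_lincomb:
  "lin_ext n g (\<lambda>i. \<Sum>x\<in>A. c x * v x i) = (\<lambda>i. \<Sum>x\<in>A. c x * lin_ext n g (v x) i)"
proof
  fix i
  have "lin_ext n g (\<lambda>i. \<Sum>x\<in>A. c x * v x i) i = (\<Sum>a<n. \<Sum>x\<in>A. c x * (v x a * g a i))"
    by (simp add: lin_ext_def sum_distrib_right mult.assoc)
  also have "\<dots> = (\<Sum>x\<in>A. c x * lin_ext n g (v x) i)"
    by (subst sum.swap) (simp add: lin_ext_def sum_distrib_left)
  finally show "lin_ext n g (\<lambda>i. \<Sum>x\<in>A. c x * v x i) i = (\<Sum>x\<in>A. c x * lin_ext n g (v x) i)" .
qed

lemma lin_ext_smul_bas: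
  assumes "a < n"
  shows "lin_ext n g (smul c (bas a)) = smul c (g a)"
proof
  fix i
  have "lin_ext n g (smul c (bas a)) i = (\<Sum>b<n. if b = a then c * g b i else 0)"
    unfolding lin_ext_def by (intro sum.cong) (simp_all add: smul_def bas_def)
  thus "lin_ext n g (smul c (bas a)) i = smul c (g a) i"
    using assms by (simp add: smul_def)
qed

lemma lin_ext_cong: "(\<And>a. a < n \<Longrightarrow> g a = h a) \<Longrightarrow> lin_ext n g v = lin_ext n h v"
  by (simp add: lin_ext_def)

lemma lin_ext_lin_ext: "lin_ext n g (lin_ext n h v) = lin_ext n (\<lambda>a. lin_ext n g (h a)) v"
  unfolding lin_ext_def[of n h v] lin_ext_lincomb by (simp add: lin_ext_def)

lemma bas_expand: "v \<in> vecs n \<Longrightarrow> v = (\<lambda>i. \<Sum>a<n. v a * bas a i)"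
proof
  fix i assume v: "v \<in> vecs n"
  have "(\<Sum>a<n. v a * bas a i) = (\<Sum>a<n. if a = i then v a else 0)"
    by (intro sum.cong) (auto simp: bas_def)
  also have "\<dots> = v i" using v by (auto simp: vecs_def)
  finally show "v i = (\<Sum>a<n. v a * bas a i)" ..
qed

lemma wshift_closed:
  assumes "n > 0"
  shows "wshift n c k v \<in> vecs n"
proof -
  have "bas (a mod n) i = 0" if "n \<le> i" for a i
    using mod_less_divisor[OF assms, of a] that by (auto simp: bas_def)
  thus ?thesis by (simp add: vecs_def wshift_def lin_ext_def smul_def)
qed

lemma wshift_smul_bas:
  "a < n \<Longrightarrow> wshift n c k (smul x (bas a)) = smul (x * c a) (bas ((a + k) mod n))"
  by (simp add: wshift_def lin_ext_smul_bas) (simp add: smul_def mult.assoc)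

text \<open>The second operator meets the index \<open>(a + k) mod n\<close>. Periodicity of
  \<open>d\<close> lets its weight be written as \<open>d (a + k)\<close>, so weights can be
  compared as formulas in unreduced natural numbers.\<close>

lemma wshift_wshift:
  assumes "n > 0" and per: "\<And>a. d (a mod n) = d a"
  shows "wshift n d m (wshift n c k v) = wshift n (\<lambda>a. c a * d (a + k)) (k + m) v"
proof -
  have "wshift n d m (smul (c a) (bas ((a + k) mod n))) =
      smul (c a * d (a + k)) (bas ((a + (k + m)) mod n))" for a
    using assms by (simp add: wshift_smul_bas mod_simps add.assoc)
  thus ?thesis
    unfolding wshift_def lin_ext_lin_ext by simp
qed

lemma wshift_cong:
  assumes "\<And>a. a < n \<Longrightarrow> c a = d a" and "k mod n = m mod n"
  shows "wshift n c k v = wshift n d m v"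
  unfolding wshift_def using assms
  by (intro lin_ext_cong) (metis mod_add_right_eq)

lemma wshift_diag:
  assumes "v \<in> vecs n" "n dvd k"
  shows "wshift n c k v = (\<lambda>i. c i * v i)"
proof
  fix i
  have "(a + k) mod n = a" if "a < n" for a
    using that assms(2) by (metis add.right_neutral dvd_eq_mod_eq_0 mod_add_right_eq mod_less)
  hence "wshift n c k v i = (\<Sum>a<n. if a = i then c a * v a else 0)"
    unfolding wshift_def lin_ext_def by (intro sum.cong) (auto simp: smul_def bas_def)
  also have "\<dots> = c i * v i" using assms(1) by (auto simp: vecs_def)
  finally show "wshift n c k v i = c i * v i" .
qed

text \<open>Lowering by one is encoded as the shift by \<open>ell r s - 1\<close>; positivity of
  \<open>ell r s\<close> guards against truncated subtraction when \<open>a + ell r s - 1\<close> is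
  regrouped.\<close>

lemma gen_act_wshift:
  assumes "ell r s > 0"
  shows "gen_act r s \<epsilon>1 \<epsilon>2 \<epsilon>3 v E1 = wshift (ell r s) (coef1 r s \<epsilon>1 \<epsilon>2 \<epsilon>3) 2 v"
    and "gen_act r s \<epsilon>1 \<epsilon>2 \<epsilon>3 v E2 = wshift (ell r s) (coef4 r s \<epsilon>1 \<epsilon>2 \<epsilon>3) (ell r s - 1) v"
  using assms by (simp_all add: wshift_def)

text \<open>Words act by iterating the generators and \<open>free_act\<close> is a linear
  combination of words, so a linear map that intertwines the two generators intertwines the whole
  free algebra.\<close>

lemma lin_ext_free_act:
  assumes "\<And>v x. lin_ext n h (gen_act r s \<epsilon>1 \<epsilon>2 \<epsilon>3 v x) = gen_act r s \<epsilon>1' \<epsilon>2' \<epsilon>3' (lin_ext n h v) x"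
  shows "lin_ext n h (free_act r s \<epsilon>1 \<epsilon>2 \<epsilon>3 v p) = free_act r s \<epsilon>1' \<epsilon>2' \<epsilon>3' (lin_ext n h v) p"
proof -
  have "lin_ext n h (foldl (gen_act r s \<epsilon>1 \<epsilon>2 \<epsilon>3) v xs) =
      foldl (gen_act r s \<epsilon>1' \<epsilon>2' \<epsilon>3') (lin_ext n h v) xs" for xs
    by (induction xs arbitrary: v) (simp_all add: assms del: gen_act.simps)
  thus ?thesis by (simp add: free_act_def lin_ext_lincomb)
qed

section \<open>The action of the elements \<open>X\<^sub>i\<close>\<close>

context
  fixes r s \<epsilon>1 \<epsilon>2 \<epsilon>3 :: complex
  assumes asm: "\<exists>n>0. r ^ n = 1" "\<exists>n>0. s ^ n = 1" "r\<^sup>2 \<noteq> s\<^sup>2" "\<epsilon>1 \<noteq> 0" "\<epsilon>2 \<noteq> 0" "\<epsilon>3 \<noteq> 0"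
begin

lemma free_act_lin_ext:
  assumes "v \<in> vecs (ell r s)"
  shows "free_act r s \<epsilon>1 \<epsilon>2 \<epsilon>3 v p = lin_ext (ell r s) (\<lambda>a. free_act r s \<epsilon>1 \<epsilon>2 \<epsilon>3 (bas a) p) v"
proof -
  have "free_act r s \<epsilon>1 \<epsilon>2 \<epsilon>3 v p =
      free_act r s \<epsilon>1 \<epsilon>2 \<epsilon>3 (\<lambda>i. \<Sum>a<ell r s. smul (v a) (bas a) i) p"
    using bas_expand[OF assms] by (simp add: smul_def)
  thus ?thesis
    unfolding fa_vsum[OF asm] fa_vsmul[OF asm] by (simp add: smul_def lin_ext_def)
qed

lemma bas_act: "a < ell r s \<Longrightarrow>
    bas a \<lhd>\<^bsub>Mmod r s \<epsilon>1 \<epsilon>2 \<epsilon>3\<^esub> UB2_class r s p = free_act r s \<epsilon>1 \<epsilon>2 \<epsilon>3 (bas a) p"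
  by (rule ract_Mmod[OF asm]) (auto simp: Mmod_simps[OF asm] vecs_def bas_def)

lemma free_act_X2:
  assumes "v \<in> vecs (ell r s)"
  shows "free_act r s \<epsilon>1 \<epsilon>2 \<epsilon>3 v (X2 r) = wshift (ell r s) (\<lambda>_. \<epsilon>1) 1 v"
  unfolding wshift_def free_act_lin_ext[OF assms]
  by (intro lin_ext_cong) (simp add: Mmod_basis(2)[OF asm] flip: bas_act)

lemma free_act_X3:
  assumes "v \<in> vecs (ell r s)"
  shows "free_act r s \<epsilon>1 \<epsilon>2 \<epsilon>3 v (X3 r s) = wshift (ell r s) (\<lambda>a. (r * s) ^ a * \<epsilon>2) 0 v"
  unfolding wshift_def free_act_lin_ext[OF assms]
  by (intro lin_ext_cong) (simp add: Mmod_basis(3)[OF asm] flip: bas_act)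

text \<open>In a right module \<open>X4\<close> acts first: it lowers the index, \<open>X2\<close>
  raises it again, and the total shift \<open>ell r s\<close> is trivial.\<close>

lemma free_act_X4_X2:
  assumes "v \<in> vecs (ell r s)"
  shows "free_act r s \<epsilon>1 \<epsilon>2 \<epsilon>3 v (X4 * X2 r) = (\<lambda>i. coef4 r s \<epsilon>1 \<epsilon>2 \<epsilon>3 i * \<epsilon>1 * v i)"
proof -
  have L: "ell r s > 0" by (rule L_pos[OF asm])
  have "free_act r s \<epsilon>1 \<epsilon>2 \<epsilon>3 v (X4 * X2 r) =
      wshift (ell r s) (\<lambda>_. \<epsilon>1) 1 (wshift (ell r s) (coef4 r s \<epsilon>1 \<epsilon>2 \<epsilon>3) (ell r s - 1) v)"
    by (simp add: fa_mult[OF asm] X4_def fa_gen[OF asm] gen_act_wshift[OF L] free_act_X2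
        wshift_closed[OF L] del: gen_act.simps)
  thus ?thesis
    using L assms by (simp add: wshift_wshift wshift_diag)
qed

text \<open>For \<open>n = ell r s\<close> the shift is trivial and the operator is the scalar
  \<open>\<epsilon>1 ^ n\<close>; this is where the \<open>ell\<close>-th power in the criterion
  comes from.\<close>

lemma free_act_X2_power:
  assumes "v \<in> vecs (ell r s)"
  shows "free_act r s \<epsilon>1 \<epsilon>2 \<epsilon>3 v (X2 r ^ n) = wshift (ell r s) (\<lambda>_. \<epsilon>1 ^ n) n v"
  using assms
proof (induction n arbitrary: v)
  case 0
  thus ?case by (simp add: fa_one[OF asm] wshift_diag)
next
  case (Suc n)
  have L: "ell r s > 0" by (rule L_pos[OF asm])
  show ?case
    by (simp add: fa_mult[OF asm] free_act_X2 Suc wshift_closed[OF L] wshift_wshift[OF L])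
qed

end

section \<open>Isomorphisms\<close>

context
  fixes r s \<epsilon>1 \<epsilon>2 \<epsilon>3 \<epsilon>1' \<epsilon>2' \<epsilon>3' :: complex
  assumes asm: "\<exists>n>0. r ^ n = 1" "\<exists>n>0. s ^ n = 1" "r\<^sup>2 \<noteq> s\<^sup>2" "\<epsilon>1 \<noteq> 0" "\<epsilon>2 \<noteq> 0" "\<epsilon>3 \<noteq> 0"
    and nz': "\<epsilon>1' \<noteq> 0" "\<epsilon>2' \<noteq> 0" "\<epsilon>3' \<noteq> 0"
begin

private lemmas asm' = asm(1-3) nz'

lemma isomorphic_imp_parameters:
  assumes "rmodule_isomorphic (UB2 r s) (Mmod r s \<epsilon>1 \<epsilon>2 \<epsilon>3) (Mmod r s \<epsilon>1' \<epsilon>2' \<epsilon>3')"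
  obtains u where "u < ell r s" "\<epsilon>1 ^ ell r s = \<epsilon>1' ^ ell r s"
    "\<epsilon>2 = (r * s) ^ u * \<epsilon>2'" "\<epsilon>3 = (r / s) ^ u * \<epsilon>3'"
proof -
  let ?L = "ell r s"
  have L: "?L > 0" by (rule L_pos[OF asm])
  have r0: "r \<noteq> 0" and s0: "s \<noteq> 0" by (rule r0[OF asm] s0[OF asm])+
  obtain f where f: "f \<in> rmodule_hom (UB2 r s) (Mmod r s \<epsilon>1 \<epsilon>2 \<epsilon>3) (Mmod r s \<epsilon>1' \<epsilon>2' \<epsilon>3')"
    and bij: "bij_betw f (vecs ?L) (vecs ?L)"
    using assms unfolding rmodule_isomorphic_def Mmod_simps[OF asm] Mmod_simps[OF asm'] by blast
  have closed: "f v \<in> vecs ?L" if "v \<in> vecs ?L" for v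
    using bij that by (auto simp: bij_betw_def)
  \<comment> \<open>A class acts as any of its representatives, so \<open>f\<close> commutes with
    the free algebra itself; with \<open>p = scal c\<close> this gives complex linearity.\<close>
  have hom: "f (free_act r s \<epsilon>1 \<epsilon>2 \<epsilon>3 v p) = free_act r s \<epsilon>1' \<epsilon>2' \<epsilon>3' (f v) p"
    if v: "v \<in> vecs ?L" for v p
  proof -
    have "f (v \<lhd>\<^bsub>Mmod r s \<epsilon>1 \<epsilon>2 \<epsilon>3\<^esub> UB2_class r s p) = f v \<lhd>\<^bsub>Mmod r s \<epsilon>1' \<epsilon>2' \<epsilon>3'\<^esub> UB2_class r s p"
      using f v by (simp add: rmodule_hom_def carrier_UB2 Mmod_simps[OF asm])
    thus ?thesis
      using v closed[OF v] by (simp add: ract_Mmod[OF asm] ract_Mmod[OF asm'] Mmod_simps[OF asm] Mmod_simps[OF asm'])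
  qed
  have b0: "bas 0 \<in> vecs ?L" using L by (auto simp: vecs_def bas_def)
  have z: "(\<lambda>_. 0) \<in> vecs ?L" by (simp add: vecs_def)
  define w where "w = f (bas 0)"
  have w: "w \<in> vecs ?L" using closed[OF b0] by (simp add: w_def)
  \<comment> \<open>Commuting with the zero element of the free algebra forces this.\<close>
  have f0: "f (\<lambda>_. 0) = (\<lambda>_. 0)"
    using hom[OF z, of 0] by (simp add: fa_zero[OF asm] fa_zero[OF asm'])
  have "bas 0 \<noteq> (\<lambda>_. 0)" by (auto simp: bas_def fun_eq_iff)
  hence "w \<noteq> (\<lambda>_. 0)"
    using bij b0 z f0 unfolding w_def bij_betw_def inj_on_def by metis
  then obtain u where wu: "w u \<noteq> 0" by auto
  have u: "u < ?L" using w wu by (force simp: vecs_def not_le)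
  \<comment> \<open>If \<open>p\<close> acts diagonally, \<open>bas 0\<close> is an eigenvector with
    eigenvalue \<open>x 0\<close>, and linearity carries this to \<open>w\<close>. Comparing
    coordinate \<open>u\<close>, where \<open>w\<close> does not vanish, gives the equality.\<close>
  have eigen: "x 0 = y u"
    if "free_act r s \<epsilon>1 \<epsilon>2 \<epsilon>3 (bas 0) p = (\<lambda>i. x i * bas 0 i)"
      and y: "free_act r s \<epsilon>1' \<epsilon>2' \<epsilon>3' w p = (\<lambda>i. y i * w i)" for p x y
  proof -
    have "free_act r s \<epsilon>1 \<epsilon>2 \<epsilon>3 (bas 0) p = smul (x 0) (bas 0)"
      using that(1) by (simp add: smul_def bas_def fun_eq_iff)
    also have "\<dots> = free_act r s \<epsilon>1 \<epsilon>2 \<epsilon>3 (bas 0) (scal (x 0))"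
      by (simp add: fa_scal[OF asm])
    finally have "f (free_act r s \<epsilon>1 \<epsilon>2 \<epsilon>3 (bas 0) p) = smul (x 0) w"
      by (simp add: hom[OF b0] fa_scal[OF asm'] flip: w_def)
    hence "smul (x 0) w = (\<lambda>i. y i * w i)" by (simp add: hom[OF b0] y flip: w_def)
    hence "x 0 * w u = y u * w u" by (simp add: smul_def fun_eq_iff)
    thus ?thesis using wu by simp
  qed
  have 1: "\<epsilon>1 ^ ?L = \<epsilon>1' ^ ?L"
    by (rule eigen[of "X2 r ^ ?L" "\<lambda>_. \<epsilon>1 ^ ?L" "\<lambda>_. \<epsilon>1' ^ ?L"])
      (simp_all add: free_act_X2_power[OF asm] free_act_X2_power[OF asm'] wshift_diag b0 w)
  have 2: "\<epsilon>2 = (r * s) ^ u * \<epsilon>2'"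
    using eigen[of "X3 r s" "\<lambda>a. (r * s) ^ a * \<epsilon>2" "\<lambda>a. (r * s) ^ a * \<epsilon>2'"]
    by (simp add: free_act_X3[OF asm] free_act_X3[OF asm'] wshift_diag b0 w)
  have X: "coef4 r s \<epsilon>1 \<epsilon>2 \<epsilon>3 0 * \<epsilon>1 = coef4 r s \<epsilon>1' \<epsilon>2' \<epsilon>3' u * \<epsilon>1'"
    using eigen[of "X4 * X2 r" "\<lambda>a. coef4 r s \<epsilon>1 \<epsilon>2 \<epsilon>3 a * \<epsilon>1" "\<lambda>a. coef4 r s \<epsilon>1' \<epsilon>2' \<epsilon>3' a * \<epsilon>1'"]
    by (simp add: free_act_X4_X2[OF asm] free_act_X4_X2[OF asm'] b0 w)
  define S Q where "S = s ^ (2 * u)" and "Q = (r / s) ^ u"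
  have rsu: "(r * s) ^ u = Q * S"
    using s0 by (simp add: S_def Q_def power_mult power2_eq_square flip: power_mult_distrib)
  have SQ: "S \<noteq> 0" "Q \<noteq> 0" using r0 s0 by (simp_all add: S_def Q_def)
  have d: "1 - r / s \<noteq> 0" by (rule nz(1)[OF asm])
  have "\<epsilon>2 * inverse \<epsilon>3 * (\<epsilon>3 - 1) = \<epsilon>2' * inverse \<epsilon>3' * ((\<epsilon>3' * Q - 1) * S)"
  proof -
    have "coef4 r s \<epsilon>1 \<epsilon>2 \<epsilon>3 0 * \<epsilon>1 * (1 - r / s) = \<epsilon>2 * inverse \<epsilon>3 * (\<epsilon>3 - 1)"
      using d asm(4) by (simp add: coef4_def)
    moreover have "coef4 r s \<epsilon>1' \<epsilon>2' \<epsilon>3' u * \<epsilon>1' * (1 - r / s) =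
        \<epsilon>2' * inverse \<epsilon>3' * ((\<epsilon>3' * Q - 1) * S)"
      using d nz'(1) by (simp add: coef4_def S_def Q_def)
    ultimately show ?thesis using X by simp
  qed
  \<comment> \<open>After \<open>\<epsilon>2 = Q * S * \<epsilon>2'\<close> is substituted, the
    terms \<open>Q * S * \<epsilon>2'\<close> on both sides cancel, leaving
    \<open>Q / \<epsilon>3 = 1 / \<epsilon>3'\<close>.\<close>
  hence "\<epsilon>2' * S * (\<epsilon>3 - Q * \<epsilon>3') = 0"
    using asm nz' unfolding 2 rsu by (simp add: field_simps)
  hence "\<epsilon>3 = (r / s) ^ u * \<epsilon>3'" using SQ nz' by (simp add: Q_def)
  thus thesis using that u 1 2 by blast
qed

lemma parameters_imp_isomorphic:
  assumes u: "u < ell r s"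
    and eq: "\<epsilon>1 ^ ell r s = \<epsilon>1' ^ ell r s" "\<epsilon>2 = (r * s) ^ u * \<epsilon>2'" "\<epsilon>3 = (r / s) ^ u * \<epsilon>3'"
  shows "rmodule_isomorphic (UB2 r s) (Mmod r s \<epsilon>1 \<epsilon>2 \<epsilon>3) (Mmod r s \<epsilon>1' \<epsilon>2' \<epsilon>3')"
proof -
  let ?L = "ell r s"
  have L: "?L > 0" by (rule L_pos[OF asm])
  have r0: "r \<noteq> 0" and s0: "s \<noteq> 0" by (rule r0[OF asm] s0[OF asm])+
  \<comment> \<open>Commuting with \<open>X2\<close> dictates the ratio of consecutive weights:
    \<open>\<epsilon>1\<close> times the weight at \<open>a + 1\<close> must equal
    \<open>\<epsilon>1'\<close> times the weight at \<open>a\<close>.\<close>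
  define \<mu> where "\<mu> = \<epsilon>1' / \<epsilon>1"
  have mu0: "\<mu> \<noteq> 0" and e1': "\<epsilon>1' = \<mu> * \<epsilon>1" using asm(4) nz' by (simp_all add: \<mu>_def)
  have muL: "\<mu> ^ ?L = 1" using eq(1) nz' by (simp add: \<mu>_def power_divide)
  have mu_mod: "\<mu> ^ (a mod ?L) = \<mu> ^ a" for a by (rule pow_mod[OF asm muL])
  have mu_pred: "\<mu> ^ (a + (?L - 1)) * \<mu> = \<mu> ^ a" for a
  proof -
    have "a + (?L - 1) + 1 = a + ?L" using L by simp
    thus ?thesis using muL by (metis mult.right_neutral power_add power_one_right)
  qed
  define T where "T = wshift ?L (\<lambda>a. \<mu> ^ a) u"
  \<comment> \<open>The inverse sends \<open>e'(b)\<close> back to index \<open>b - u\<close>,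
    written \<open>b + (ell r s - u)\<close>, and divides by the weight \<mu> to the power
    \<open>b - u\<close>.\<close>
  define T' where "T' = wshift ?L (\<lambda>a. \<mu> ^ u / \<mu> ^ a) (?L - u)"
  define S Q where "S = s ^ (2 * u)" and "Q = (r / s) ^ u"
  have rsu: "(r * s) ^ u = Q * S"
    using s0 by (simp add: S_def Q_def power_mult power2_eq_square flip: power_mult_distrib)
  have SQ: "S \<noteq> 0" "Q \<noteq> 0" using r0 s0 by (simp_all add: S_def Q_def)
  \<comment> \<open>The factor \<open>\<mu>^2\<close> turns \<open>\<epsilon>1^2\<close> into
    \<open>\<epsilon>1'^2\<close>, and the change in \<open>\<epsilon>3 / \<epsilon>2\<close> is the
    factor \<open>1 / S\<close> from moving the index by \<open>u\<close>.\<close>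
  have c1: "coef1 r s \<epsilon>1 \<epsilon>2 \<epsilon>3 a * \<mu> ^ (a + 2) = \<mu> ^ a * coef1 r s \<epsilon>1' \<epsilon>2' \<epsilon>3' (a + u)" for a
  proof -
    have "s ^ (2 * (a + u)) = s ^ (2 * a) * S" by (simp add: S_def power_add distrib_left)
    moreover have "\<epsilon>3 * inverse \<epsilon>2 = \<epsilon>3' * inverse \<epsilon>2' * inverse S"
      unfolding eq rsu Q_def[symmetric] using SQ nz' by (simp add: field_simps)
    ultimately show ?thesis
      unfolding coef1_def e1' power_add
      by (simp add: power_mult_distrib mult_ac)
  qed
  \<comment> \<open>Here \<open>\<mu> ^ (a + (ell r s - 1))\<close> stands for
    \<open>\<mu> ^ a / \<mu>\<close>, which turns the inverse of \<open>\<epsilon>1\<close> into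
    that of \<open>\<epsilon>1'\<close>. The bracket containing \<open>\<epsilon>3\<close> is
    unchanged by the shift, and \<open>S\<close> comes from
    \<open>\<epsilon>2 / \<epsilon>3\<close>.\<close>
  have c4: "coef4 r s \<epsilon>1 \<epsilon>2 \<epsilon>3 a * \<mu> ^ (a + (?L - 1)) = \<mu> ^ a * coef4 r s \<epsilon>1' \<epsilon>2' \<epsilon>3' (a + u)" for a
  proof -
    have S: "s ^ (2 * (a + u)) = s ^ (2 * a) * S" by (simp add: S_def power_add distrib_left)
    have Q: "\<epsilon>3' * (r / s) ^ (a + u) = \<epsilon>3 * (r / s) ^ a" by (simp add: eq power_add)
    have i: "\<epsilon>2 * inverse \<epsilon>3 = \<epsilon>2' * inverse \<epsilon>3' * S"
      unfolding eq rsu Q_def[symmetric] using SQ nz' by (simp add: field_simps)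
    have m: "\<mu> ^ (a + (?L - 1)) = \<mu> ^ a * inverse \<mu>"
      using mu_pred[of a] mu0 by (simp add: field_simps)
    have "coef4 r s \<epsilon>1 \<epsilon>2 \<epsilon>3 a * \<mu> ^ (a + (?L - 1)) = (\<epsilon>2 * inverse \<epsilon>3) *
        (inverse \<epsilon>1 * ((\<epsilon>3 * (r / s) ^ a - 1) * s ^ (2 * a) / (1 - r / s)) * (\<mu> ^ a * inverse \<mu>))"
      unfolding coef4_def m by (simp add: mult_ac)
    also have "\<dots> = \<mu> ^ a * coef4 r s \<epsilon>1' \<epsilon>2' \<epsilon>3' (a + u)"
      unfolding coef4_def S Q i e1' by (simp add: mult_ac)
    finally show ?thesis .
  qed
  \<comment> \<open>Both sides are weighted shifts by the same amount, with weights matched by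
    \<open>c1\<close> and \<open>c4\<close>.\<close>
  have comm: "T (gen_act r s \<epsilon>1 \<epsilon>2 \<epsilon>3 v x) = gen_act r s \<epsilon>1' \<epsilon>2' \<epsilon>3' (T v) x" for v x
    by (cases x)
      (simp_all only: T_def gen_act_wshift[OF L] wshift_wshift[OF L] c1_mod[OF asm']
        c4_mod[OF asm'] mu_mod c1 c4 add.commute[of u])
  have T_act: "T (free_act r s \<epsilon>1 \<epsilon>2 \<epsilon>3 v p) = free_act r s \<epsilon>1' \<epsilon>2' \<epsilon>3' (T v) p" for v p
    using comm unfolding T_def wshift_def by (rule lin_ext_free_act)
  have T_closed: "T v \<in> vecs ?L" "T' v \<in> vecs ?L" for v
    by (simp_all add: T_def T'_def wshift_closed[OF L])
  have "T' (T v) = v" if "v \<in> vecs ?L" for v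
    using that u mu0 by (simp add: T_def T'_def wshift_wshift[OF L] mu_mod wshift_diag power_add)
  moreover have "T (T' v) = v" if "v \<in> vecs ?L" for v
  proof -
    \<comment> \<open>In this order the weight of \<open>T\<close> is taken at
      \<open>a + (ell r s - u)\<close>, so the cancellation uses
      \<open>\<mu> ^ ell r s = 1\<close>.\<close>
    have "\<mu> ^ u * \<mu> ^ (?L - u) = 1" using u muL by (simp flip: power_add)
    hence weight: "\<mu> ^ u / \<mu> ^ a * \<mu> ^ (a + (?L - u)) = 1" for a
      using mu0 unfolding power_add by (simp add: field_simps)
    show ?thesis
      unfolding T_def T'_def wshift_wshift[OF L, of "\<lambda>a. \<mu> ^ a", OF mu_mod] weight
      using that u by (simp add: wshift_diag)
  qed
  ultimately have "bij_betw T (vecs ?L) (vecs ?L)"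
    using T_closed by (intro bij_betw_byWitness[of _ T']) auto
  moreover have "T \<in> rmodule_hom (UB2 r s) (Mmod r s \<epsilon>1 \<epsilon>2 \<epsilon>3) (Mmod r s \<epsilon>1' \<epsilon>2' \<epsilon>3')"
    using T_closed
    by (auto simp: rmodule_hom_def Mmod_simps[OF asm] Mmod_simps[OF asm'] carrier_UB2
        ract_Mmod[OF asm] ract_Mmod[OF asm'] T_act)
      (simp add: T_def wshift_def lin_ext_add)
  ultimately show ?thesis
    unfolding rmodule_isomorphic_def Mmod_simps[OF asm] Mmod_simps[OF asm'] by blast
qed

end

theorem theorem10p3:
  fixes r s \<epsilon>1 \<epsilon>2 \<epsilon>3 \<epsilon>1' \<epsilon>2' \<epsilon>3' :: complex
  assumes "\<exists>n>0. r ^ n = 1" and "\<exists>n>0. s ^ n = 1" and "r\<^sup>2 \<noteq> s\<^sup>2"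
    and "\<epsilon>1 \<noteq> 0" and "\<epsilon>2 \<noteq> 0" and "\<epsilon>3 \<noteq> 0"
    and "\<epsilon>1' \<noteq> 0" and "\<epsilon>2' \<noteq> 0" and "\<epsilon>3' \<noteq> 0"
  shows "rmodule_isomorphic (UB2 r s) (Mmod r s \<epsilon>1 \<epsilon>2 \<epsilon>3) (Mmod r s \<epsilon>1' \<epsilon>2' \<epsilon>3') \<longleftrightarrow>
    (\<exists>u::nat. 0 \<le> u \<and> u \<le> ell r s - 1 \<and>
      \<epsilon>1 ^ ell r s = \<epsilon>1' ^ ell r s \<and>
      \<epsilon>2 = (r * s) ^ u * \<epsilon>2' \<and>
      \<epsilon>3 = (r / s) ^ u * \<epsilon>3')"
proof -
  \<comment> \<open>Truncated subtraction makes this depend on \<open>ell r s > 0\<close>.\<close>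
  have "u \<le> ell r s - 1 \<longleftrightarrow> u < ell r s" for u
    using L_pos[OF assms(1-6)] by linarith
  thus ?thesis
    using isomorphic_imp_parameters[OF assms] parameters_imp_isomorphic[OF assms] by (metis le0)
qed

end
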